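(* For every $F\in\mathrm{et}(\mathbb{C}^2)$ the right composition mapping $R_F:\mathrm{et}(\mathbb{C}^2)\to\mathrm{et}(\mathbb{C}^2)$, $R_F(G)=G\circ F$, is injective.
   Context: $\mathrm{et}(\mathbb{C}^2)$ denotes the set of all polynomial mappings $G=(G_1,G_2)\in\mathbb{C}[X,Y]^2$ such that $\det J_G\equiv 1$ (where $J_G$ is the Jacobian matrix of $G$), $\deg G_1=\deg_Y G_1$ and $\deg G_2=\deg_Y G_2$. With composition $\circ$ as binary operation it is taken to be a semigroup.
   Formalization: R_F is taken as a map from et(C^2) into all pairs of polynomials, since et(C^2) as defined is not closed under composition: G=(X-Y,Y) and F=(X+Y,Y) lie in it but G∘F=(X,Y) does not; injectivity on et(C^2) is stated in full. *)

theory Defs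
  imports "HOL-Analysis.Analysis" "HOL-Computational_Algebra.Polynomial"
begin

text \<open>
  C[X,Y] is represented as (C[X])[Y]: the outer variable is Y, and the coefficient of
  X^i Y^j in p is coeff (coeff p j) i. Hence degree p is the degree of p in Y.
\<close>

type_synonym bipoly = "complex poly poly"

definition total_degree :: "bipoly \<Rightarrow> nat" where
  "total_degree p = Max (insert 0 {i + j | i j. coeff (coeff p j) i \<noteq> 0})"

lemma finite_support: "finite {i + j | i j. coeff (coeff (p :: bipoly) j) i \<noteq> 0}"
proof (rule finite_subset)
  show "{i + j | i j. coeff (coeff p j) i \<noteq> 0}
          \<subseteq> (\<lambda>(i, j). i + j) ` (SIGMA i:(\<Union>j\<le>degree p. {..degree (coeff p j)}). {..degree p})"
  proof safe
    fix i j assume "coeff (coeff p j) i \<noteq> 0"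
    then have "i \<le> degree (coeff p j)" "j \<le> degree p"
      by (auto intro!: le_degree)
    then show "i + j \<in> (\<lambda>(i, j). i + j) ` (SIGMA i:(\<Union>j\<le>degree p. {..degree (coeff p j)}). {..degree p})"
      by (intro image_eqI[of _ _ "(i, j)"]) auto
  qed
qed auto

definition deg_Y :: "bipoly \<Rightarrow> nat" where
  "deg_Y p = degree p"

definition diff_X :: "bipoly \<Rightarrow> bipoly" where
  "diff_X p = map_poly pderiv p"

definition diff_Y :: "bipoly \<Rightarrow> bipoly" where
  "diff_Y p = pderiv p"

definition jacobian_matrix :: "bipoly \<times> bipoly \<Rightarrow> bipoly ^ 2 ^ 2" where
  "jacobian_matrix G =
     vector [vector [diff_X (fst G), diff_Y (fst G)],
             vector [diff_X (snd G), diff_Y (snd G)]]"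

definition et_C2 :: "(bipoly \<times> bipoly) set" where
  "et_C2 = {G. det (jacobian_matrix G) = 1
             \<and> total_degree (fst G) = deg_Y (fst G)
             \<and> total_degree (snd G) = deg_Y (snd G)}"

definition subst_XY :: "bipoly \<Rightarrow> bipoly \<Rightarrow> bipoly \<Rightarrow> bipoly" where
  "subst_XY p a b =
     (\<Sum>j\<le>degree p. \<Sum>i\<le>degree (coeff p j). smult [:coeff (coeff p j) i:] (a ^ i * b ^ j))"

definition comp_map :: "bipoly \<times> bipoly \<Rightarrow> bipoly \<times> bipoly \<Rightarrow> bipoly \<times> bipoly" where
  "comp_map G F = (subst_XY (fst G) (fst F) (snd F), subst_XY (snd G) (fst F) (snd F))"

definition right_comp :: "bipoly \<times> bipoly \<Rightarrow> bipoly \<times> bipoly \<Rightarrow> bipoly \<times> bipoly" where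
  "right_comp F = (\<lambda>G. comp_map G F)"

text \<open>
  Composition can leave et_C2: for G = (X - Y, Y) and F = (X + Y, Y), both in et_C2,
  G o F = (X, Y) is not in et_C2. right_comp F is therefore regarded as a map into all pairs of polynomials.
\<close>

end

theory Submission
  imports Defs
begin

text \<open>
  Substituting \<open>F\<close> into a polynomial is additive, so injectivity of \<open>G \<mapsto> G \<circ> F\<close> amounts
  to the algebraic independence of the two components \<open>a, b\<close> of \<open>F\<close>. The latter is the
  Jacobian criterion in characteristic 0. Suppose \<open>p(a, b) = 0\<close>. Differentiating with
  respect to \<open>X\<close> and \<open>Y\<close> gives, by the chain rule, a homogeneous linear system
  for \<open>p\<^sub>X(a, b)\<close> and \<open>p\<^sub>Y(a, b)\<close> whose matrix is the transpose of the Jacobian matrix of \<open>F\<close>,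
  of determinant 1. Hence both partial derivatives of \<open>p\<close> are again annihilated by the
  substitution (\<open>partials_vanish_at_unimodular_pair\<close>), and they have smaller total degree.
  By induction they are zero, so \<open>p\<close> is a constant, and a constant that vanishes after
  substitution is zero (\<open>unimodular_pair_algebraically_independent\<close>).

  The substitution is treated as an iterated one-variable evaluation, so additivity and the
  chain rule are proved once for one variable, by induction on the polynomial, and then
  applied first in \<open>X\<close> and then in \<open>Y\<close>.
\<close>

text \<open>
  The coefficient map \<open>f\<close> is arbitrary because the chain rule below also evaluates with
  \<open>D \<circ> f\<close> for a derivation \<open>D\<close>, which is additive but not multiplicative.
\<close>
definition eval_with :: "('a::zero \<Rightarrow> 'b::comm_ring_1) \<Rightarrow> 'a poly \<Rightarrow> 'b \<Rightarrow> 'b" where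
  "eval_with f p b = (\<Sum>j\<le>degree p. f (coeff p j) * b ^ j)"

lemma eval_with_0: "f 0 = 0 \<Longrightarrow> eval_with f 0 b = 0"
  by (simp add: eval_with_def)

lemma eval_with_pCons:
  assumes "f 0 = 0"
  shows "eval_with f (pCons c p) b = f c + b * eval_with f p b"
proof (cases "p = 0")
  case True
  then show ?thesis using assms by (cases "c = 0") (simp_all add: eval_with_def)
next
  case False
  then show ?thesis
    by (simp add: eval_with_def sum.atMost_Suc_shift sum_distrib_left algebra_simps
        del: sum.atMost_Suc)
qed

lemma eval_with_add:
  fixes p q :: "'a::comm_monoid_add poly"
  assumes zero: "f 0 = 0" and add: "\<And>x y. f (x + y) = f x + f y"
  shows "eval_with f (p + q) b = eval_with f p b + eval_with f q b"
  by (induction p q rule: poly_induct2)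
     (simp_all add: eval_with_0 eval_with_pCons zero add algebra_simps)

definition is_derivation :: "('a::comm_ring_1 \<Rightarrow> 'a) \<Rightarrow> bool" where
  "is_derivation D \<longleftrightarrow>
     (\<forall>x y. D (x + y) = D x + D y) \<and> (\<forall>x y. D (x * y) = D x * y + x * D y)"

lemma derivation_0: "is_derivation D \<Longrightarrow> D 0 = 0"
  unfolding is_derivation_def by (metis add_cancel_left_left)

text \<open>
  The one-variable chain rule. A derivation of the target ring may also act on the images of
  the coefficients, which accounts for the first summand; this is what makes the rule
  applicable when \<open>f\<close> is itself a substitution for the other variable.
\<close>
lemma derivation_eval_with:
  fixes f :: "'a::{comm_semiring_1,semiring_no_zero_divisors} \<Rightarrow> 'b::comm_ring_1"
  assumes D: "is_derivation D" and zero: "f 0 = 0" and add: "\<And>x y. f (x + y) = f x + f y"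
  shows "D (eval_with f p b) =
           eval_with (\<lambda>c. D (f c)) p b + eval_with f (pderiv p) b * D b"
proof (induction p)
  case 0
  then show ?case by (simp add: eval_with_0 zero derivation_0[OF D])
next
  case (pCons c p)
  have rules: "D (x + y) = D x + D y" "D (x * y) = D x * y + x * D y" for x y
    using D by (auto simp: is_derivation_def)
  have "D (eval_with f (pCons c p) b) =
      D (f c) + (D b * eval_with f p b + b * D (eval_with f p b))"
    by (simp add: eval_with_pCons zero rules)
  moreover have "eval_with (\<lambda>c. D (f c)) (pCons c p) b =
      D (f c) + b * eval_with (\<lambda>c. D (f c)) p b"
    by (simp add: eval_with_pCons zero derivation_0[OF D])
  moreover have "eval_with f (pderiv (pCons c p)) b =
      eval_with f p b + b * eval_with f (pderiv p) b"
    by (simp add: pderiv_pCons eval_with_add eval_with_pCons zero add)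
  ultimately show ?case by (simp add: pCons.IH algebra_simps)
qed

definition subst_X :: "bipoly \<Rightarrow> complex poly \<Rightarrow> bipoly" where
  "subst_X a c = eval_with (\<lambda>z. [:[:z:]:]) c a"

lemma subst_X_0 [simp]: "subst_X a 0 = 0"
  by (simp add: subst_X_def eval_with_0)

lemma subst_X_add: "subst_X a (c + d) = subst_X a c + subst_X a d"
  unfolding subst_X_def by (rule eval_with_add) simp_all

lemma subst_XY_eval_with: "subst_XY p a b = eval_with (subst_X a) p b"
  by (simp add: subst_XY_def eval_with_def subst_X_def sum_distrib_right mult.assoc)

lemma subst_XY_add: "subst_XY (p + q) a b = subst_XY p a b + subst_XY q a b"
  unfolding subst_XY_eval_with by (rule eval_with_add) (simp_all add: subst_X_add)

lemma subst_XY_diff: "subst_XY (p - q) a b = subst_XY p a b - subst_XY q a b"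
  using subst_XY_add[of "p - q" q a b] by simp

lemma subst_XY_const: "subst_XY [:[:z:]:] a b = [:[:z:]:]"
  by (simp add: subst_XY_def)

lemma derivation_subst_X:
  assumes D: "is_derivation D" and const: "\<And>z. D [:[:z:]:] = 0"
  shows "D (subst_X a c) = subst_X a (pderiv c) * D a"
  unfolding subst_X_def
  by (subst derivation_eval_with[OF D]) (simp_all add: const eval_with_def)

lemma eval_with_map_poly:
  assumes "f 0 = 0" "g 0 = 0"
  shows "eval_with (\<lambda>c. f (g c) * e) p b = eval_with f (map_poly g p) b * e"
  by (induction p)
     (simp_all add: assms eval_with_0 eval_with_pCons map_poly_pCons algebra_simps)

lemma derivation_subst_XY:
  assumes D: "is_derivation D" and const: "\<And>z. D [:[:z:]:] = 0"
  shows "D (subst_XY p a b) =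
           subst_XY (diff_X p) a b * D a + subst_XY (diff_Y p) a b * D b"
  unfolding subst_XY_eval_with diff_X_def diff_Y_def
  by (subst derivation_eval_with[OF D])
     (simp_all add: subst_X_add derivation_subst_X[OF D const] eval_with_map_poly)

lemma is_derivation_diff_Y: "is_derivation diff_Y"
  by (simp add: is_derivation_def diff_Y_def pderiv_add pderiv_mult algebra_simps)

lemma diff_X_add: "diff_X (p + q) = diff_X p + diff_X q"
  by (rule poly_eqI) (simp add: diff_X_def coeff_map_poly pderiv_add)

lemma diff_X_smult: "diff_X (smult c p) = smult (pderiv c) p + smult c (diff_X p)"
  by (rule poly_eqI) (simp add: diff_X_def coeff_map_poly pderiv_mult algebra_simps)

lemma diff_X_pCons: "diff_X (pCons c p) = pCons (pderiv c) (diff_X p)"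
  by (simp add: diff_X_def map_poly_pCons)

lemma diff_X_mult: "diff_X (p * q) = diff_X p * q + p * diff_X q"
proof (induction p)
  case 0
  then show ?case by (simp add: diff_X_def)
next
  case (pCons c p)
  then show ?case
    by (simp add: diff_X_add diff_X_smult diff_X_pCons add_pCons algebra_simps)
qed

lemma is_derivation_diff_X: "is_derivation diff_X"
  by (simp add: is_derivation_def diff_X_add diff_X_mult)

lemma coeff_diff_X: "coeff (coeff (diff_X p) j) i = of_nat (Suc i) * coeff (coeff p j) (Suc i)"
  by (simp add: diff_X_def coeff_map_poly coeff_pderiv)

lemma coeff_diff_Y: "coeff (coeff (diff_Y p) j) i = of_nat (Suc j) * coeff (coeff p (Suc j)) i"
  by (simp add: diff_Y_def coeff_pderiv of_nat_poly del: of_nat_Suc)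

text \<open>
  The chain rule turns the two partial derivatives of \<open>p(a, b) = 0\<close> into a linear system for
  \<open>p\<^sub>X(a, b)\<close> and \<open>p\<^sub>Y(a, b)\<close>, and Cramer's rule shows that its only solution is zero.
\<close>
lemma partials_vanish_at_unimodular_pair:
  assumes jac: "diff_X a * diff_Y b - diff_Y a * diff_X b = 1"
    and zero: "subst_XY p a b = 0"
  shows "subst_XY (diff_X p) a b = 0" and "subst_XY (diff_Y p) a b = 0"
proof -
  define u v where "u = subst_XY (diff_X p) a b" and "v = subst_XY (diff_Y p) a b"
  have X: "u * diff_X a + v * diff_X b = 0"
    using derivation_subst_XY[OF is_derivation_diff_X, of p a b] zero
    by (simp add: u_def v_def diff_X_pCons) (simp add: diff_X_def)
  have Y: "u * diff_Y a + v * diff_Y b = 0"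
    using derivation_subst_XY[OF is_derivation_diff_Y, of p a b] zero
    by (simp add: u_def v_def diff_Y_def pderiv_pCons)
  have "u = u * (diff_X a * diff_Y b - diff_Y a * diff_X b)"
    by (simp add: jac)
  also have "\<dots> = (u * diff_X a + v * diff_X b) * diff_Y b
                 - (u * diff_Y a + v * diff_Y b) * diff_X b"
    by (simp add: algebra_simps)
  also have "\<dots> = 0"
    by (simp only: X Y) simp
  finally show "subst_XY (diff_X p) a b = 0"
    by (simp add: u_def)
  have "v = v * (diff_X a * diff_Y b - diff_Y a * diff_X b)"
    by (simp add: jac)
  also have "\<dots> = (u * diff_Y a + v * diff_Y b) * diff_X a
                 - (u * diff_X a + v * diff_X b) * diff_Y a"
    by (simp add: algebra_simps)
  also have "\<dots> = 0"
    by (simp only: X Y) simp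
  finally show "subst_XY (diff_Y p) a b = 0"
    by (simp add: v_def)
qed

text \<open>
  Descent on the total degree: \<open>n\<close> bounds it strictly, so that \<open>n = 0\<close> forces \<open>p = 0\<close>, and each
  partial derivative lowers the bound by one.
\<close>
lemma unimodular_pair_algebraically_independent_bounded:
  assumes jac: "diff_X a * diff_Y b - diff_Y a * diff_X b = 1"
    and "subst_XY p a b = 0"
    and "\<And>i j. n \<le> i + j \<Longrightarrow> coeff (coeff p j) i = 0"
  shows "p = 0"
  using assms(2,3)
proof (induction n arbitrary: p)
  case 0
  then show ?case by (intro poly_eqI) simp
next
  case (Suc n)
  note partials = partials_vanish_at_unimodular_pair[OF jac Suc.prems(1)]
  have dX: "diff_X p = 0"
    by (rule Suc.IH[OF partials(1)]) (simp add: coeff_diff_X Suc.prems(2))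
  have dY: "diff_Y p = 0"
    by (rule Suc.IH[OF partials(2)]) (simp add: coeff_diff_Y Suc.prems(2))
  have X: "coeff (coeff p j) (Suc i) = 0" for i j
    using coeff_diff_X[of p j i] dX by (simp del: of_nat_Suc)
  have Y: "coeff (coeff p (Suc j)) i = 0" for i j
    using coeff_diff_Y[of p j i] dY by (simp del: of_nat_Suc)
  have p: "p = [:[:coeff (coeff p 0) 0:]:]"
    by (intro poly_eqI) (simp add: coeff_pCons X Y split: nat.split)
  have "p = subst_XY p a b"
    by (subst (1 2) p) (simp only: subst_XY_const)
  then show ?case using Suc.prems(1) by simp
qed

lemma unimodular_pair_algebraically_independent:
  assumes "diff_X a * diff_Y b - diff_Y a * diff_X b = 1" and "subst_XY p a b = 0"
  shows "p = 0"
proof (rule unimodular_pair_algebraically_independent_bounded[OF assms])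
  fix i j assume "Suc (total_degree p) \<le> i + j"
  moreover have "i + j \<le> total_degree p" if "coeff (coeff p j) i \<noteq> 0"
    unfolding total_degree_def using that finite_support[of p] by (intro Max_ge) auto
  ultimately show "coeff (coeff p j) i = 0" by force
qed

theorem proposition3p3:
  assumes "F \<in> et_C2"
  shows "inj_on (right_comp F) et_C2"
proof (rule inj_onI)
  fix G H assume eq: "right_comp F G = right_comp F H"
  obtain a b where F: "F = (a, b)" by (cases F)
  have jac: "diff_X a * diff_Y b - diff_Y a * diff_X b = 1"
    using assms by (simp add: F et_C2_def jacobian_matrix_def det_2)
  have inj: "p = q" if "subst_XY p a b = subst_XY q a b" for p q
    using unimodular_pair_algebraically_independent[OF jac, of "p - q"] that
    by (simp add: subst_XY_diff)
  show "G = H"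
    using eq by (auto simp: right_comp_def comp_map_def F intro!: prod_eqI inj)
qed

end
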